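(* Let $\psi:T\to\mathbb{C}$ be such that $M_\psi$ is a bounded multiplication operator from $\mathcal{L}$ to $\mathcal{L}_{\mathbf{w}}$ (or equivalently from $\mathcal{L}_0$ to $\mathcal{L}_{\mathbf{w},0}$). Then the following are equivalent: (a) $M_\psi:\mathcal{L}\to\mathcal{L}_{\mathbf{w}}$ is compact. (b) $M_\psi:\mathcal{L}_0\to\mathcal{L}_{\mathbf{w},0}$ is compact. (c) $\displaystyle\lim_{|v|\to\infty}|v|^2D\psi(v)=0$ and $\displaystyle\lim_{|v|\to\infty}(|v|+1)|\psi(v)|=0$.
   Context: $T$ is the vertex set of a tree (a locally finite, connected, simply connected graph), rooted at a vertex $o$ and without terminal vertices (a terminal vertex is one having a unique neighbor), hence infinite. $|v|$ is the number of edges in the path from $o$ to $v$; $T^*=T\setminus\{o\}$; for $v\in T^*$, $v^-$ is the neighbor of $v$ closest to $o$. For $f:T\to\mathbb{C}$ and $v\in T^*$, $Df(v)=|f(v)-f(v^-)|$. The Lipschitz space $\mathcal{L}$ is the Banach space of all $f:T\to\mathbb{C}$ with $\sup_{v\in T^*}Df(v)<\infty$, with norm $\|f\|_{\mathcal{L}}=|f(o)|+\sup_{v\in T^*}Df(v)$; the little Lipschitz space is the closed subspace $\mathcal{L}_0=\{f\in\mathcal{L}:\lim_{|v|\to\infty}Df(v)=0\}$. The weighted Lipschitz space $\mathcal{L}_{\mathbf{w}}$ is the Banach space of all $f:T\to\mathbb{C}$ with $\sup_{v\in T^*}|v|Df(v)<\infty$, with norm $\|f\|_{\mathbf{w}}=|f(o)|+\sup_{v\in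 T^*}|v|Df(v)$; the little weighted Lipschitz space is the closed subspace $\mathcal{L}_{\mathbf{w},0}=\{f\in\mathcal{L}_{\mathbf{w}}:\lim_{|v|\to\infty}|v|Df(v)=0\}$. For $\psi:T\to\mathbb{C}$, $M_\psi f=\psi f$ (pointwise product). "$M_\psi:X\to Y$ is bounded" means that $\psi f\in Y$ for all $f\in X$ and $M_\psi$ is a bounded linear operator. For functions $\psi$ on $T$, boundedness of $M_\psi:\mathcal{L}\to\mathcal{L}_{\mathbf{w}}$ and boundedness of $M_\psi:\mathcal{L}_0\to\mathcal{L}_{\mathbf{w},0}$ are equivalent. *)

theory Defs
  imports "HOL-Analysis.Analysis"
begin

section \<open>Trees\<close>

text \<open>
  The vertex set is the whole (infinite) type \<open>'v\<close>, and \<open>adj\<close> is the edge relation.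
  Acyclicity is the graph-theoretic form of simple connectedness.  Infinity is listed
  separately because the one-point tree has no vertex with a unique neighbor.
  \<open>Graph_Theory\<close>'s \<open>tree\<close> does not fit: it forbids directed cycles, and a symmetric
  digraph with an edge has one.
\<close>

locale infinite_tree =
  fixes adj :: "'v \<Rightarrow> 'v \<Rightarrow> bool"
  assumes adj_sym: "symp adj"
    and adj_irrefl: "irreflp adj"
    and locally_finite: "\<And>v. finite {w. adj v w}"
    and connected: "\<And>u v. adj\<^sup>*\<^sup>* u v"
    and acyclic: "\<not> (\<exists>xs. length xs \<ge> 3 \<and> distinct xs \<and> successively adj xs \<and> adj (last xs) (hd xs))"
    and no_terminal: "\<And>v. \<not> (\<exists>!w. adj v w)"
    and infinite_vertices: "infinite (UNIV :: 'v set)"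

definition simple_path :: "('v \<Rightarrow> 'v \<Rightarrow> bool) \<Rightarrow> 'v \<Rightarrow> 'v list \<Rightarrow> 'v \<Rightarrow> bool" where
  "simple_path adj u xs v \<longleftrightarrow>
     xs \<noteq> [] \<and> hd xs = u \<and> last xs = v \<and> distinct xs \<and> successively adj xs"

text \<open>\<open>level adj rt v\<close> is $|v|$, the number of edges in the path from the root \<open>rt\<close> to \<open>v\<close>.\<close>

definition level :: "('v \<Rightarrow> 'v \<Rightarrow> bool) \<Rightarrow> 'v \<Rightarrow> 'v \<Rightarrow> nat" where
  "level adj rt v = length (THE xs. simple_path adj rt xs v) - 1"

text \<open>\<open>parent adj rt v\<close> is $v^-$; it is meaningful only for \<open>v \<noteq> rt\<close>.\<close>

definition parent :: "('v \<Rightarrow> 'v \<Rightarrow> bool) \<Rightarrow> 'v \<Rightarrow> 'v \<Rightarrow> 'v" where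
  "parent adj rt v =
     (THE u. adj v u \<and> (\<forall>w. adj v w \<longrightarrow> level adj rt u \<le> level adj rt w))"

text \<open>The filter describing $|v| \to \infty$.\<close>

definition at_boundary :: "('v \<Rightarrow> 'v \<Rightarrow> bool) \<Rightarrow> 'v \<Rightarrow> 'v filter" where
  "at_boundary adj rt = filtercomap (level adj rt) at_top"


section \<open>Lipschitz spaces on a tree\<close>

definition tree_D :: "('v \<Rightarrow> 'v \<Rightarrow> bool) \<Rightarrow> 'v \<Rightarrow> ('v \<Rightarrow> complex) \<Rightarrow> 'v \<Rightarrow> real" where
  "tree_D adj rt f v = cmod (f v - f (parent adj rt v))"

definition lip :: "('v \<Rightarrow> 'v \<Rightarrow> bool) \<Rightarrow> 'v \<Rightarrow> ('v \<Rightarrow> complex) set" where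
  "lip adj rt = {f. bdd_above (tree_D adj rt f ` (- {rt}))}"

definition lip_norm :: "('v \<Rightarrow> 'v \<Rightarrow> bool) \<Rightarrow> 'v \<Rightarrow> ('v \<Rightarrow> complex) \<Rightarrow> real" where
  "lip_norm adj rt f = cmod (f rt) + (SUP v\<in>- {rt}. tree_D adj rt f v)"

definition lip0 :: "('v \<Rightarrow> 'v \<Rightarrow> bool) \<Rightarrow> 'v \<Rightarrow> ('v \<Rightarrow> complex) set" where
  "lip0 adj rt = {f \<in> lip adj rt. (tree_D adj rt f \<longlongrightarrow> 0) (at_boundary adj rt)}"

definition wlip :: "('v \<Rightarrow> 'v \<Rightarrow> bool) \<Rightarrow> 'v \<Rightarrow> ('v \<Rightarrow> complex) set" where
  "wlip adj rt = {f. bdd_above ((\<lambda>v. real (level adj rt v) * tree_D adj rt f v) ` (- {rt}))}"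

definition wlip_norm :: "('v \<Rightarrow> 'v \<Rightarrow> bool) \<Rightarrow> 'v \<Rightarrow> ('v \<Rightarrow> complex) \<Rightarrow> real" where
  "wlip_norm adj rt f =
     cmod (f rt) + (SUP v\<in>- {rt}. real (level adj rt v) * tree_D adj rt f v)"

definition wlip0 :: "('v \<Rightarrow> 'v \<Rightarrow> bool) \<Rightarrow> 'v \<Rightarrow> ('v \<Rightarrow> complex) set" where
  "wlip0 adj rt = {f \<in> wlip adj rt.
     ((\<lambda>v. real (level adj rt v) * tree_D adj rt f v) \<longlongrightarrow> 0) (at_boundary adj rt)}"


section \<open>Operators between normed spaces of functions\<close>

text \<open>
  The spaces depend on the tree, so a normed space is given by a carrier \<open>X\<close> and a
  norm \<open>N\<close> on it.
  The metric induced by the norm is set to \<open>0\<close> off the carrier, where the norm is a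
  supremum of a possibly unbounded set: \<^locale>\<open>Metric_space\<close> requires nonnegativity on
  the whole type.
\<close>

definition norm_dist ::
  "('v \<Rightarrow> complex) set \<Rightarrow> (('v \<Rightarrow> complex) \<Rightarrow> real) \<Rightarrow> ('v \<Rightarrow> complex) \<Rightarrow> ('v \<Rightarrow> complex) \<Rightarrow> real" where
  "norm_dist X N f g = (if f \<in> X \<and> g \<in> X then N (\<lambda>v. f v - g v) else 0)"

definition linear_operator ::
  "('v \<Rightarrow> complex) set \<Rightarrow> ('v \<Rightarrow> complex) set \<Rightarrow> (('v \<Rightarrow> complex) \<Rightarrow> 'v \<Rightarrow> complex) \<Rightarrow> bool" where
  "linear_operator X Y A \<longleftrightarrow>
     (\<forall>f\<in>X. A f \<in> Y) \<and>
     (\<forall>f\<in>X. \<forall>g\<in>X. A (\<lambda>v. f v + g v) = (\<lambda>v. A f v + A g v)) \<and>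
     (\<forall>c. \<forall>f\<in>X. A (\<lambda>v. c * f v) = (\<lambda>v. c * A f v))"

definition bounded_operator ::
  "('v \<Rightarrow> complex) set \<Rightarrow> (('v \<Rightarrow> complex) \<Rightarrow> real) \<Rightarrow> ('v \<Rightarrow> complex) set \<Rightarrow>
   (('v \<Rightarrow> complex) \<Rightarrow> real) \<Rightarrow> (('v \<Rightarrow> complex) \<Rightarrow> 'v \<Rightarrow> complex) \<Rightarrow> bool" where
  "bounded_operator X NX Y NY A \<longleftrightarrow>
     linear_operator X Y A \<and> (\<exists>C. \<forall>f\<in>X. NY (A f) \<le> C * NX f)"

text \<open>A compact operator maps bounded sets to sets with compact closure in the target.\<close>

definition compact_operator ::
  "('v \<Rightarrow> complex) set \<Rightarrow> (('v \<Rightarrow> complex) \<Rightarrow> real) \<Rightarrow> ('v \<Rightarrow> complex) set \<Rightarrow>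
   (('v \<Rightarrow> complex) \<Rightarrow> real) \<Rightarrow> (('v \<Rightarrow> complex) \<Rightarrow> 'v \<Rightarrow> complex) \<Rightarrow> bool" where
  "compact_operator X NX Y NY A \<longleftrightarrow>
     linear_operator X Y A \<and>
     (\<forall>B. Metric_space.mbounded X (norm_dist X NX) B \<longrightarrow>
        compactin (Metric_space.mtopology Y (norm_dist Y NY))
          (Metric_space.mtopology Y (norm_dist Y NY) closure_of (A ` B)))"

definition mult_op :: "('v \<Rightarrow> complex) \<Rightarrow> ('v \<Rightarrow> complex) \<Rightarrow> 'v \<Rightarrow> complex" where
  "mult_op \<psi> f = (\<lambda>v. \<psi> v * f v)"

end

theory Submission
  imports Defs
begin

text \<open>
  If (c) holds, then the Leibniz rule for $D$ bounds $|v|\,D(\psi f)(v)$ for all $f$ with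
  $\|f\|_{\mathcal L} \le R$ by $R\,e(v)$, where $e$ does not depend on $f$ and tends to $0$ at the
  boundary; the functions dominated in this way form a compact set.  Conversely, let $F_v$ be
  finitely supported functions that are bounded in $\mathcal L$ and tend to $0$ pointwise as
  $|v| \to \infty$.  Compactness forces $\|\psi F_v\|_{\mathbf w} \to 0$.  For the indicator of $v$
  this gives $|v|\,|\psi(v)| \to 0$; for the radial tent function with peak value $|v|$ at level
  $|v|$ it gives $|v|^2 D\psi(v) \to 0$.  Finitely supported functions lie in $\mathcal L_0$, so
  the argument covers both pairs of spaces.
\<close>

section \<open>Existence and uniqueness of simple paths in a tree\<close>

lemma simple_path_prefix:
  "simple_path adj u (xs @ z # ys) v \<Longrightarrow> simple_path adj u (xs @ [z]) z"
  unfolding simple_path_def by (cases xs) (auto simp: successively_append_iff successively_Cons hd_append)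

lemma simple_path_snoc:
  "simple_path adj u xs v \<Longrightarrow> adj v w \<Longrightarrow> w \<notin> set xs \<Longrightarrow> simple_path adj u (xs @ [w]) w"
  by (auto simp: simple_path_def successively_append_iff)

context infinite_tree
begin

lemma adj_commute: "adj u v \<longleftrightarrow> adj v u"
  using adj_sym by (auto dest: sympD)

lemma successively_adj_rev: "successively adj (rev xs) \<longleftrightarrow> successively adj xs"
  by (simp add: successively_rev adj_commute)

text \<open>A walk is followed edge by edge. If the next vertex already lies on the path, the path
  is cut off there instead of being extended, which keeps it simple.\<close>

lemma simple_path_exists: "\<exists>xs. simple_path adj u xs v"
  using connected[of u v]
proof induction
  case base
  have "simple_path adj u [u] u" by (simp add: simple_path_def)
  then show ?case by blast
next
  case (step y z)
  then obtain xs where xs: "simple_path adj u xs y" by blast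
  show ?case
  proof (cases "z \<in> set xs")
    case True
    then obtain as bs where "xs = as @ z # bs" by (meson split_list)
    then show ?thesis using xs simple_path_prefix by metis
  next
    case False
    then show ?thesis using simple_path_snoc[OF xs] step by blast
  qed
qed

text \<open>Common initial steps are removed by induction. Where the two paths first diverge, they
  must meet again, at \<open>v\<close> at the latest, and the pieces in between would close a
  cycle.\<close>

lemma simple_path_unique:
  "simple_path adj u xs v \<Longrightarrow> simple_path adj u ys v \<Longrightarrow> xs = ys"
proof (induction xs arbitrary: u ys)
  case Nil
  then show ?case by (simp add: simple_path_def)
next
  case (Cons x xs)
  have x: "x = u" using Cons.prems by (simp add: simple_path_def)
  obtain ys' where ys: "ys = u # ys'"
    using Cons.prems by (cases ys) (auto simp: simple_path_def)
  consider "xs = []" | "ys' = []" | "xs \<noteq> []" "ys' \<noteq> []" by blast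
  then show ?case
  proof cases
    case 1
    then show ?thesis using Cons.prems x ys by (auto simp: simple_path_def split: if_splits)
  next
    case 2
    then show ?thesis using Cons.prems x ys by (auto simp: simple_path_def split: if_splits)
  next
    case 3
    have sx: "simple_path adj (hd xs) xs v" and sy: "simple_path adj (hd ys') ys' v"
      and ax: "adj u (hd xs)" and ay: "adj u (hd ys')"
      using 3 Cons.prems x ys by (auto simp: simple_path_def successively_Cons)
    show ?thesis
    proof (cases "hd xs = hd ys'")
      case True
      then show ?thesis using Cons.IH sx sy x ys by metis
    next
      case False
      have "last xs \<in> set xs" "last xs \<in> set ys'"
        using sx sy 3 by (auto simp: simple_path_def) (metis last_in_set)
      then have "\<exists>z\<in>set xs. z \<in> set ys'" by blast
      then obtain as z bs where xs: "xs = as @ z # bs" "z \<in> set ys'" "\<forall>a\<in>set as. a \<notin> set ys'"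
        using split_list_first_prop[of xs "\<lambda>z. z \<in> set ys'"] by blast
      then obtain cs ds where ys': "ys' = cs @ z # ds" by (meson split_list)
      \<comment> \<open>The cycle leaves \<open>u\<close> along \<open>xs\<close> up to
        \<open>z\<close> and returns along \<open>ys'\<close> reversed. Taking the first
        \<open>z\<close> of \<open>xs\<close> on \<open>ys'\<close> makes the arcs disjoint; as the
        tails have different heads, \<open>as\<close> and \<open>cs\<close> are not both empty,
        which gives length at least 3.\<close>
      let ?c = "u # as @ z # rev cs"
      have "as \<noteq> [] \<or> cs \<noteq> []" using False xs ys' by auto
      then have "length ?c \<ge> 3" by (cases as; cases cs) auto
      moreover have "distinct ?c"
        using Cons.prems xs ys ys' x by (auto simp: simple_path_def)
      moreover have "successively adj ?c"
      proof -
        have "successively adj (rev (cs @ [z]))"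
          using sy ys' unfolding successively_adj_rev
          by (auto simp: simple_path_def successively_append_iff)
        moreover have "successively adj (u # as @ [z])"
          using sx ax xs
          by (cases as) (auto simp: simple_path_def successively_append_iff successively_Cons hd_append)
        ultimately show ?thesis
          by (cases cs rule: rev_cases) (auto simp: successively_append_iff successively_Cons hd_append)
      qed
      moreover have "adj (last ?c) (hd ?c)"
        using ay ys' by (cases cs) (auto simp: adj_commute)
      ultimately show ?thesis using acyclic by blast
    qed
  qed
qed

end

section \<open>Levels, parents, the boundary filter and the difference operator\<close>

locale rooted_tree = infinite_tree adj for adj :: "'v \<Rightarrow> 'v \<Rightarrow> bool" +
  fixes rt :: 'v
begin

abbreviation "lv \<equiv> level adj rt"
abbreviation "par \<equiv> parent adj rt"
abbreviation "D \<equiv> tree_D adj rt"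
abbreviation "bd \<equiv> at_boundary adj rt"

lemma level_eqI: "simple_path adj rt xs v \<Longrightarrow> lv v = length xs - 1"
  unfolding level_def by (metis (mono_tags) simple_path_unique the_equality)

lemma level_root [simp]: "lv rt = 0"
  using level_eqI[of "[rt]" rt] by (simp add: simple_path_def)

text \<open>The next-to-last vertex \<open>u\<close> of the root path of \<open>v\<close> lies one
  level below \<open>v\<close>, whereas all other neighbors lie one level above; so \<open>u\<close>
  is the unique minimizer in the definition of \<open>parent\<close>.\<close>

lemma parent_props:
  assumes "v \<noteq> rt"
  shows "adj v (par v) \<and> lv v = Suc (lv (par v))"
proof -
  obtain xs where xs: "simple_path adj rt xs v" using simple_path_exists by blast
  obtain ys where ys: "xs = ys @ [v]" using xs by (cases xs rule: rev_cases) (auto simp: simple_path_def)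
  obtain zs u where zs: "ys = zs @ [u]"
    using xs ys assms by (cases ys rule: rev_cases) (auto simp: simple_path_def)
  have u: "simple_path adj rt (zs @ [u]) u" using xs ys zs simple_path_prefix[of adj rt zs u "[v]"] by simp
  have uv: "adj v u" using xs ys zs by (auto simp: simple_path_def successively_append_iff adj_commute)
  have lu: "lv v = Suc (lv u)" using level_eqI[OF u] level_eqI[OF xs] ys zs by simp
  \<comment> \<open>A neighbor \<open>w\<close> on the root path of \<open>v\<close> would give a
    second simple path to \<open>v\<close>, through \<open>w\<close> directly, unless
    \<open>w = u\<close>. So \<open>w\<close> is off the path and extends it.\<close>
  have other: "lv w = Suc (lv v)" if "adj v w" "w \<noteq> u" for w
  proof -
    have "w \<notin> set xs"
    proof
      assume "w \<in> set xs"
      then obtain as bs where ab: "xs = as @ w # bs" by (meson split_list)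
      have w: "simple_path adj rt (as @ [w]) w" using xs ab simple_path_prefix by metis
      have "v \<noteq> w" using that adj_irrefl by (auto simp: irreflp_def)
      then have "bs \<noteq> []" using ab ys by auto
      then have "v \<in> set bs" using ab ys by (cases bs rule: rev_cases) auto
      then have "v \<notin> set (as @ [w])" using xs ab by (auto simp: simple_path_def)
      then have "simple_path adj rt ((as @ [w]) @ [v]) v"
        using simple_path_snoc[OF w] that adj_commute by blast
      then have "xs = (as @ [w]) @ [v]" using xs simple_path_unique by blast
      then show False using that ys zs by simp
    qed
    then have "simple_path adj rt (xs @ [w]) w" using simple_path_snoc[OF xs] that by blast
    from level_eqI[OF this] level_eqI[OF xs] show ?thesis using ys by simp
  qed
  have "par v = u" unfolding parent_def
  proof (rule the_equality)
    show "adj v u \<and> (\<forall>w. adj v w \<longrightarrow> lv u \<le> lv w)" using uv other lu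
      by (metis le_SucI order_refl)
  next
    fix w assume "adj v w \<and> (\<forall>w'. adj v w' \<longrightarrow> lv w \<le> lv w')"
    then show "w = u" using other[of w] lu uv by fastforce
  qed
  then show ?thesis using uv lu by simp
qed

lemmas adj_parent = parent_props[THEN conjunct1]
lemmas level_parent = parent_props[THEN conjunct2]

lemma level_ge_1: "v \<noteq> rt \<Longrightarrow> 1 \<le> real (lv v)"
  by (simp add: level_parent)

text \<open>Every nonroot vertex is adjacent to its parent, one level below, so local finiteness
  propagates outward from the root.\<close>

lemma finite_level_le: "finite {v. lv v \<le> n}"
proof (induction n)
  case 0
  have "{v. lv v \<le> 0} \<subseteq> {rt}" using level_parent by fastforce
  then show ?case using finite_subset by blast
next
  case (Suc n)
  have "{v. lv v \<le> Suc n} \<subseteq> {rt} \<union> (\<Union>u\<in>{v. lv v \<le> n}. {w. adj u w})"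
  proof
    fix v assume "v \<in> {v. lv v \<le> Suc n}"
    then show "v \<in> {rt} \<union> (\<Union>u\<in>{v. lv v \<le> n}. {w. adj u w})"
      using adj_parent[of v] level_parent[of v] adj_commute by (cases "v = rt") auto
  qed
  moreover have "finite ({rt} \<union> (\<Union>u\<in>{v. lv v \<le> n}. {w. adj u w}))"
    using Suc locally_finite by blast
  ultimately show ?case by (rule finite_subset)
qed

lemma nonroot_nonempty: "- {rt} \<noteq> {}"
  using infinite_vertices by (metis Compl_eq_Diff_UNIV finite.emptyI finite.insertI infinite_remove)

lemma eventually_boundary: "eventually P bd \<longleftrightarrow> (\<exists>N. \<forall>v. N \<le> lv v \<longrightarrow> P v)"
  by (simp add: at_boundary_def eventually_filtercomap_at_top_linorder)

lemma eventually_nonroot: "\<forall>\<^sub>F v in bd. v \<noteq> rt"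
  unfolding eventually_boundary by (rule exI[of _ 1]) auto

text \<open>The parent is only one level lower. This transfers limits at the boundary to the values
  at \<open>par v\<close> that appear in the Leibniz rule.\<close>

lemma filterlim_parent: "filterlim par bd bd"
  unfolding filterlim_iff eventually_boundary
proof (intro allI impI)
  fix P assume "\<exists>N. \<forall>v. N \<le> lv v \<longrightarrow> P v"
  then obtain N where N: "\<And>v. N \<le> lv v \<Longrightarrow> P v" by blast
  have "P (par v)" if "Suc N \<le> lv v" for v
    using N[of "par v"] level_parent[of v] that by (cases "v = rt") auto
  then show "\<exists>N. \<forall>v. N \<le> lv v \<longrightarrow> P (par v)" by blast
qed

text \<open>Beyond some level \<open>e\<close> is below 1, and only finitely many vertices
  remain.\<close>

lemma boundary_tendsto_0_imp_bounded:
  fixes e :: "'v \<Rightarrow> real"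
  assumes "(e \<longlongrightarrow> 0) bd"
  obtains M where "\<And>v. e v \<le> M"
proof -
  have "\<forall>\<^sub>F v in bd. e v < 1" using assms by (rule order_tendstoD) simp
  then obtain N where N: "\<And>v. N \<le> lv v \<Longrightarrow> e v < 1" unfolding eventually_boundary by blast
  let ?S = "insert 1 (e ` {v. lv v \<le> N})"
  have "finite ?S" using finite_level_le by simp
  moreover have "e v \<le> 1 \<or> e v \<in> ?S" for v using N[of v] by (cases "lv v \<le> N") auto
  ultimately have "e v \<le> Max ?S" for v
    by (meson Max_ge insertI1 order_trans)
  then show thesis using that by blast
qed

lemma eventually_0_of_finite_support:
  assumes "finite {w. f w \<noteq> 0}"
  shows "\<forall>\<^sub>F v in bd. f v = 0"
proof -
  obtain N where "\<forall>w\<in>{w. f w \<noteq> 0}. lv w \<le> N"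
    using assms by (metis finite_imageI finite_nat_set_iff_bounded_le imageI)
  then have "\<forall>v. Suc N \<le> lv v \<longrightarrow> f v = 0" by fastforce
  then show ?thesis unfolding eventually_boundary by blast
qed

lemma tree_D_add_le: "D (\<lambda>v. f v + g v) v \<le> D f v + D g v"
  unfolding tree_D_def by (metis add_diff_add norm_triangle_ineq)

lemma tree_D_minus_commute: "D (\<lambda>v. f v - g v) v = D (\<lambda>v. g v - f v) v"
proof -
  have "(f v - g v) - (f (par v) - g (par v)) = - ((g v - f v) - (g (par v) - f (par v)))" by simp
  then show ?thesis unfolding tree_D_def by (metis norm_minus_cancel)
qed

text \<open>Discrete Leibniz rule: the increment of a product splits into the increment of
  \<open>\<psi>\<close> times \<open>f\<close> at the child, plus \<open>\<psi>\<close> at the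
  parent times the increment of \<open>f\<close>.\<close>

lemma tree_D_mult_le: "D (\<lambda>v. \<psi> v * f v) v \<le> D \<psi> v * cmod (f v) + cmod (\<psi> (par v)) * D f v"
proof -
  have "\<psi> v * f v - \<psi> (par v) * f (par v) = (\<psi> v - \<psi> (par v)) * f v + \<psi> (par v) * (f v - f (par v))"
    by (simp add: algebra_simps)
  then show ?thesis unfolding tree_D_def by (metis norm_mult norm_triangle_ineq)
qed

text \<open>The reverse triangle inequality for the same splitting; it serves to isolate
  \<open>D \<psi> v\<close> when \<open>f\<close> is a test function.\<close>

lemma tree_D_mult_ge: "D \<psi> v * cmod (f v) - cmod (\<psi> (par v)) * D f v \<le> D (\<lambda>v. \<psi> v * f v) v"
proof -
  have "\<psi> v * f v - \<psi> (par v) * f (par v) = (\<psi> v - \<psi> (par v)) * f v + \<psi> (par v) * (f v - f (par v))"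
    by (simp add: algebra_simps)
  then show ?thesis unfolding tree_D_def by (metis norm_mult norm_diff_ineq)
qed

end

section \<open>Weighted Lipschitz norms and their metrics\<close>

text \<open>The weights \<open>k v = 1\<close> and \<open>k v = \<bar>v\<bar>\<close> give $\mathcal L$ and $\mathcal L_{\mathbf w}$.\<close>

locale weighted_tree = rooted_tree +
  fixes k :: "'a \<Rightarrow> real"
  assumes weight_ge_1: "\<And>v. v \<noteq> rt \<Longrightarrow> 1 \<le> k v"
begin

definition wt_lip :: "('a \<Rightarrow> complex) set" where
  "wt_lip = {f. bdd_above ((\<lambda>v. k v * D f v) ` (- {rt}))}"

definition wt_norm :: "('a \<Rightarrow> complex) \<Rightarrow> real" where
  "wt_norm f = cmod (f rt) + (SUP v\<in>- {rt}. k v * D f v)"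

lemma weight_nonneg: "v \<noteq> rt \<Longrightarrow> 0 \<le> k v"
  using weight_ge_1[of v] by simp

lemma wt_lipI: "(\<And>v. v \<noteq> rt \<Longrightarrow> k v * D f v \<le> b) \<Longrightarrow> f \<in> wt_lip"
  unfolding wt_lip_def by (auto intro!: bdd_aboveI2)

lemma wt_norm_leI:
  "(\<And>v. v \<noteq> rt \<Longrightarrow> k v * D f v \<le> b) \<Longrightarrow> wt_norm f \<le> cmod (f rt) + b"
  unfolding wt_norm_def using nonroot_nonempty by (auto intro!: cSUP_least)

lemma wt_norm_ge: "f \<in> wt_lip \<Longrightarrow> v \<noteq> rt \<Longrightarrow> cmod (f rt) + k v * D f v \<le> wt_norm f"
  unfolding wt_norm_def wt_lip_def by (auto intro!: cSUP_upper)

lemma wt_norm_ge_root: "f \<in> wt_lip \<Longrightarrow> cmod (f rt) \<le> wt_norm f"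
proof -
  assume f: "f \<in> wt_lip"
  obtain v where v: "v \<noteq> rt" using nonroot_nonempty by auto
  have "0 \<le> k v * D f v" using weight_nonneg[OF v] by (simp add: tree_D_def)
  then show ?thesis using wt_norm_ge[OF f v] by linarith
qed

lemma wt_norm_nonneg: "f \<in> wt_lip \<Longrightarrow> 0 \<le> wt_norm f"
  using wt_norm_ge_root[of f] norm_ge_zero[of "f rt"] by linarith

lemma weighted_D_le_wt_norm: "f \<in> wt_lip \<Longrightarrow> v \<noteq> rt \<Longrightarrow> k v * D f v \<le> wt_norm f"
  using wt_norm_ge[of f v] norm_ge_zero[of "f rt"] by linarith

lemma tree_D_le_wt_norm: "f \<in> wt_lip \<Longrightarrow> v \<noteq> rt \<Longrightarrow> D f v \<le> wt_norm f"
  using weighted_D_le_wt_norm[of f v] mult_right_mono[OF weight_ge_1, of v "D f v"]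
  by (simp add: tree_D_def)

text \<open>Telescoping along the path from the root: the root value and each of the
  \<open>lv v\<close> increments contribute at most one norm. Hence point evaluations are
  continuous.\<close>

lemma cmod_le_wt_norm: "f \<in> wt_lip \<Longrightarrow> cmod (f v) \<le> (real (lv v) + 1) * wt_norm f"
proof (induction "lv v" arbitrary: v)
  case 0
  then have "v = rt" using level_parent[of v] by (cases "v = rt") auto
  then show ?case using wt_norm_ge_root[OF 0(2)] by simp
next
  case (Suc n)
  then have v: "v \<noteq> rt" by auto
  have "cmod (f v) \<le> cmod (f (par v)) + D f v"
    unfolding tree_D_def by (metis norm_triangle_sub)
  also have "\<dots> \<le> (real (lv (par v)) + 1) * wt_norm f + wt_norm f"
    using Suc(1)[of "par v"] Suc(2,3) level_parent[OF v] tree_D_le_wt_norm[OF Suc(3) v] by simp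
  also have "\<dots> = (real (lv v) + 1) * wt_norm f"
    using level_parent[OF v] by (simp add: algebra_simps)
  finally show ?case .
qed

lemma wt_lip_add:
  assumes "f \<in> wt_lip" "g \<in> wt_lip"
  shows "(\<lambda>v. f v + g v) \<in> wt_lip" "wt_norm (\<lambda>v. f v + g v) \<le> wt_norm f + wt_norm g"
proof -
  \<comment> \<open>The norm minus the root value is the supremum part, so \<open>?b\<close> is the
    sum of the two seminorms.\<close>
  let ?b = "wt_norm f - cmod (f rt) + (wt_norm g - cmod (g rt))"
  have *: "k v * D (\<lambda>v. f v + g v) v \<le> ?b" if "v \<noteq> rt" for v
  proof -
    have "k v * D (\<lambda>v. f v + g v) v \<le> k v * (D f v + D g v)"
      using tree_D_add_le weight_nonneg[OF that] by (intro mult_left_mono)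
    also have "\<dots> \<le> ?b"
      using wt_norm_ge[OF assms(1) that] wt_norm_ge[OF assms(2) that] by (simp add: algebra_simps)
    finally show ?thesis .
  qed
  show "(\<lambda>v. f v + g v) \<in> wt_lip" using * by (rule wt_lipI)
  have "wt_norm (\<lambda>v. f v + g v) \<le> cmod (f rt + g rt) + ?b" using * by (rule wt_norm_leI)
  then show "wt_norm (\<lambda>v. f v + g v) \<le> wt_norm f + wt_norm g"
    using norm_triangle_ineq[of "f rt" "g rt"] by linarith
qed

lemma wt_lip_diff:
  assumes "f \<in> wt_lip" "g \<in> wt_lip"
  shows "(\<lambda>v. f v - g v) \<in> wt_lip"
proof -
  have "(\<lambda>v. - g v) \<in> wt_lip"
    using assms(2) by (simp add: wt_lip_def tree_D_def norm_minus_commute)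
  from wt_lip_add(1)[OF assms(1) this] show ?thesis by simp
qed

lemma wt_norm_minus_commute: "wt_norm (\<lambda>v. f v - g v) = wt_norm (\<lambda>v. g v - f v)"
  unfolding wt_norm_def by (subst tree_D_minus_commute) (simp add: norm_minus_commute)

lemma wt_norm_eq_0: "f \<in> wt_lip \<Longrightarrow> wt_norm f = 0 \<Longrightarrow> f v = 0"
  using cmod_le_wt_norm[of f v] by simp

lemma wt_norm_0: "wt_norm (\<lambda>v. 0) = 0"
  unfolding wt_norm_def tree_D_def using nonroot_nonempty by simp

text \<open>Differences of elements of \<open>Y\<close> stay in \<open>wt_lip\<close>, where the
  norm is subadditive, and separation of points follows from the pointwise bound.\<close>

lemma Metric_space_norm_dist:
  assumes "Y \<subseteq> wt_lip"
  shows "Metric_space Y (norm_dist Y wt_norm)"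
proof
  fix f g
  show "0 \<le> norm_dist Y wt_norm f g"
    using assms wt_norm_nonneg wt_lip_diff by (auto simp: norm_dist_def subset_iff)
  show "norm_dist Y wt_norm f g = norm_dist Y wt_norm g f"
    by (simp add: norm_dist_def wt_norm_minus_commute[of f g])
next
  fix f g assume fg: "f \<in> Y" "g \<in> Y"
  have "f = g" if "wt_norm (\<lambda>v. f v - g v) = 0"
    using wt_norm_eq_0[OF _ that] wt_lip_diff fg assms by (auto simp: fun_eq_iff subset_iff)
  then show "norm_dist Y wt_norm f g = 0 \<longleftrightarrow> f = g"
    using fg by (auto simp: norm_dist_def wt_norm_0)
next
  fix f g h assume "f \<in> Y" "g \<in> Y" "h \<in> Y"
  then show "norm_dist Y wt_norm f h \<le> norm_dist Y wt_norm f g + norm_dist Y wt_norm g h"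
    using wt_lip_add(2)[of "\<lambda>v. f v - g v" "\<lambda>v. g v - h v"] wt_lip_diff assms
    by (simp add: norm_dist_def subset_iff)
qed

lemma mbounded_norm_dist_iff:
  assumes "X \<subseteq> wt_lip" "(\<lambda>v. 0) \<in> X"
  shows "Metric_space.mbounded X (norm_dist X wt_norm) B \<longleftrightarrow> B \<subseteq> X \<and> (\<exists>R. \<forall>f\<in>B. wt_norm f \<le> R)"
proof -
  interpret M: Metric_space X "norm_dist X wt_norm" using Metric_space_norm_dist[OF assms(1)] .
  have d0: "norm_dist X wt_norm (\<lambda>v. 0) f = wt_norm f" if "f \<in> X" for f
    using that assms(2) wt_norm_minus_commute[of f "\<lambda>v. 0"] by (simp add: norm_dist_def)
  show ?thesis
  proof
    assume B: "M.mbounded B"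
    then have BX: "B \<subseteq> X" using M.mbounded_subset_mspace by blast
    \<comment> \<open>Adjoining the zero function keeps \<open>B\<close> bounded, so distances can
      be measured from zero, where they are norms.\<close>
    obtain R where "\<forall>f\<in>B. norm_dist X wt_norm (\<lambda>v. 0) f \<le> R"
      using B assms(2) by (metis M.mbounded_alt M.mbounded_insert insertCI)
    then show "B \<subseteq> X \<and> (\<exists>R. \<forall>f\<in>B. wt_norm f \<le> R)" using BX d0 by (metis subsetD)
  next
    assume "B \<subseteq> X \<and> (\<exists>R. \<forall>f\<in>B. wt_norm f \<le> R)"
    then obtain R where "B \<subseteq> X" "\<forall>f\<in>B. wt_norm f \<le> R" by blast
    then have "B \<subseteq> M.mcball (\<lambda>v. 0) R" using d0 assms(2) by (auto simp: subset_iff)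
    then show "M.mbounded B" unfolding M.mbounded_def by blast
  qed
qed

text \<open>On a set of functions whose weighted differences share a majorant vanishing at the boundary,
  pointwise convergence implies norm convergence, so Tychonoff's theorem applies.\<close>

lemma compactin_dominated:
  assumes Y: "Y \<subseteq> wt_lip" and e: "(e \<longlongrightarrow> 0) bd"
    and K: "K = {g. cmod (g rt) \<le> a \<and> (\<forall>v. v \<noteq> rt \<longrightarrow> k v * D g v \<le> e v)}" and KY: "K \<subseteq> Y"
  shows "compactin (Metric_space.mtopology Y (norm_dist Y wt_norm)) K"
proof -
  interpret M: Metric_space Y "norm_dist Y wt_norm" using Metric_space_norm_dist[OF Y] .
  obtain M where M: "\<And>v. e v \<le> M" using boundary_tendsto_0_imp_bounded[OF e] by blast
  \<comment> \<open>On \<open>K\<close> the norm is at most \<open>a + M\<close>, so the pointwise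
    bound places \<open>K\<close> in this product of compact discs.\<close>
  let ?P = "PiE UNIV (\<lambda>v. cball (0::complex) ((real (lv v) + 1) * (a + M)))"
  have "compactin (product_topology (\<lambda>_. euclidean) UNIV) ?P"
    by (subst compactin_PiE) simp
  then have P: "compact ?P" by (simp add: euclidean_product_topology)
  have "K \<subseteq> ?P"
  proof (safe intro!: PiE_I)
    fix g v assume g: "g \<in> K"
    then have *: "k v * D g v \<le> M" if "v \<noteq> rt" for v using M[of v] that order_trans unfolding K by blast
    have "wt_norm g \<le> a + M" using wt_norm_leI[OF *] g unfolding K by auto
    have "cmod (g v) \<le> (real (lv v) + 1) * wt_norm g"
      using cmod_le_wt_norm[OF wt_lipI[OF *]] .
    also have "\<dots> \<le> (real (lv v) + 1) * (a + M)"
      using \<open>wt_norm g \<le> a + M\<close> by (intro mult_left_mono) auto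
    finally show "g v \<in> cball 0 ((real (lv v) + 1) * (a + M))"
      by simp
  qed auto
  moreover have "closed K"
  proof -
    \<comment> \<open>Each condition is a weak inequality in one or two coordinates, hence closed in
      the product topology.\<close>
    have "K = {g. cmod (g rt) \<le> a} \<inter> (\<Inter>v\<in>-{rt}. {g. k v * D g v \<le> e v})"
      unfolding K by auto
    moreover have "closed {g :: 'a \<Rightarrow> complex. cmod (g rt) \<le> a}"
      by (intro closed_Collect_le continuous_intros continuous_on_product_coordinates)
    moreover have "closed {g. k v * D g v \<le> e v}" for v
      unfolding tree_D_def
      by (intro closed_Collect_le continuous_intros continuous_on_product_coordinates)
    ultimately show ?thesis by auto
  qed
  ultimately have "compact K" using P by (metis compact_Int_closed inf.absorb_iff2)
  then have "compactin (top_of_set K) K" by (simp add: compactin_subtopology)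
  \<comment> \<open>With the identity continuous from the pointwise to the norm topology,
    compactness of \<open>K\<close> carries over to its image, which is \<open>K\<close>
    again.\<close>
  moreover have "continuous_map (top_of_set K) M.mtopology (\<lambda>g. g)"
    unfolding M.continuous_map_to_metric
  proof (intro ballI allI impI)
    fix g and \<delta> :: real assume "g \<in> topspace (top_of_set K)" and \<delta>: "\<delta> > 0"
    then have g: "g \<in> K" by simp
    have "\<forall>\<^sub>F v in bd. e v < \<delta> / 4" using e by (rule order_tendstoD) (use \<delta> in simp)
    then obtain N where N: "\<And>v. N \<le> lv v \<Longrightarrow> e v < \<delta> / 4" unfolding eventually_boundary by blast
    let ?F = "{v. lv v \<le> N}"
    define m where "m = Max (insert 0 (k ` ?F))"
    have m: "0 \<le> m" "\<And>v. lv v \<le> N \<Longrightarrow> k v \<le> m" unfolding m_def using finite_level_le by auto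
    \<comment> \<open>A difference near the root involves two coordinates and a weight of at most
      \<open>m\<close>, costing at most \<open>\<delta> / 2\<close>; the root value adds less than
      \<open>\<delta> / 4\<close>. The summand 1 keeps the denominator positive.\<close>
    define \<eta> where "\<eta> = \<delta> / (4 * (m + 1))"
    have \<eta>: "\<eta> > 0" "\<eta> \<le> \<delta> / 4" "m * (2 * \<eta>) \<le> \<delta> / 2"
      using \<delta> m(1) by (simp_all add: \<eta>_def field_simps)
    let ?U = "\<Inter>v\<in>?F. {h. cmod (h v - g v) < \<eta>}"
    have "open ?U"
      by (intro open_INT ballI finite_level_le open_Collect_less continuous_intros
          continuous_on_product_coordinates)
    moreover have "g \<in> ?U" using \<eta> by simp
    moreover have "h \<in> M.mball g \<delta>" if h: "h \<in> ?U \<inter> K" for h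
    proof -
      have "k v * D (\<lambda>v. h v - g v) v \<le> \<delta> / 2" if v: "v \<noteq> rt" for v
      proof (cases "N \<le> lv v")
        \<comment> \<open>Far out, closeness of \<open>h\<close> to \<open>g\<close> is irrelevant:
          both are dominated by \<open>e\<close>, which is below
          \<open>\<delta> / 4\<close>.\<close>
        case True
        have "k v * D (\<lambda>v. h v + - g v) v \<le> k v * (D h v + D (\<lambda>v. - g v) v)"
          using weight_nonneg[OF v] tree_D_add_le by (intro mult_left_mono)
        also have "\<dots> = k v * D h v + k v * D g v"
          by (simp add: tree_D_def norm_minus_commute algebra_simps)
        also have "\<dots> \<le> e v + e v" using g h v unfolding K by (intro add_mono) auto
        finally show ?thesis using N[OF True] by simp
      next
        case False
        then have F: "v \<in> ?F" "par v \<in> ?F" using level_parent[OF v] by auto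
        have "D (\<lambda>v. h v - g v) v \<le> cmod (h v - g v) + cmod (h (par v) - g (par v))"
          unfolding tree_D_def by (rule norm_triangle_ineq4)
        also have "cmod (h v - g v) < \<eta>" using h F by blast
        also have "cmod (h (par v) - g (par v)) < \<eta>" using h F by blast
        finally have "D (\<lambda>v. h v - g v) v \<le> 2 * \<eta>" by simp
        then have "k v * D (\<lambda>v. h v - g v) v \<le> m * (2 * \<eta>)"
          using m F weight_nonneg[OF v] \<eta> by (intro mult_mono) (auto simp: tree_D_def)
        then show ?thesis using \<eta> by simp
      qed
      then have "wt_norm (\<lambda>v. h v - g v) \<le> cmod (h rt - g rt) + \<delta> / 2" by (rule wt_norm_leI)
      moreover have "cmod (h rt - g rt) < \<eta>" using h by auto
      ultimately have "wt_norm (\<lambda>v. h v - g v) < \<delta>" using \<eta> \<delta> by linarith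
      then show ?thesis using g h KY wt_norm_minus_commute[of g h] by (auto simp: norm_dist_def)
    qed
    ultimately show "\<exists>U. openin (top_of_set K) U \<and> g \<in> U \<and> (\<forall>h\<in>U. h \<in> M.mball g \<delta>)"
      using g by (intro exI[of _ "?U \<inter> K"]) (auto simp: openin_open)
  qed
  ultimately show ?thesis using image_compactin by fastforce
qed

end

section \<open>Condition (c) implies compactness\<close>

context rooted_tree
begin

sublocale L: weighted_tree adj rt "\<lambda>_. 1"
  by unfold_locales simp

sublocale W: weighted_tree adj rt "\<lambda>v. real (lv v)"
  by unfold_locales (rule level_ge_1)

lemma lip_eq: "lip adj rt = L.wt_lip"
  by (simp add: lip_def L.wt_lip_def)

lemma lip_norm_eq: "lip_norm adj rt = L.wt_norm"
  by (simp add: lip_norm_def L.wt_norm_def fun_eq_iff)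

lemma wlip_eq: "wlip adj rt = W.wt_lip"
  by (simp add: wlip_def W.wt_lip_def)

lemma wlip_norm_eq: "wlip_norm adj rt = W.wt_norm"
  by (simp add: wlip_norm_def W.wt_norm_def fun_eq_iff)

text \<open>The majorant is bounded above, which gives membership in the weighted space, and it
  squeezes the weighted differences to zero.\<close>

lemma wlip0I:
  assumes e: "(e \<longlongrightarrow> 0) bd" and le: "\<And>v. v \<noteq> rt \<Longrightarrow> real (lv v) * D g v \<le> e v"
  shows "g \<in> wlip0 adj rt"
proof -
  obtain M where "\<And>v. e v \<le> M" using boundary_tendsto_0_imp_bounded[OF e] by blast
  then have "g \<in> W.wt_lip" using le order_trans by (intro W.wt_lipI) blast
  moreover have "((\<lambda>v. real (lv v) * D g v) \<longlongrightarrow> 0) bd"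
  proof (rule tendsto_sandwich[OF _ _ tendsto_const e])
    show "\<forall>\<^sub>F v in bd. real (lv v) * D g v \<le> e v"
      using eventually_nonroot by eventually_elim (rule le)
  qed (simp add: tree_D_def)
  ultimately show ?thesis by (simp add: wlip0_def wlip_eq)
qed

lemma linear_operator_mult_op:
  "(\<And>f. f \<in> X \<Longrightarrow> mult_op \<psi> f \<in> Y) \<Longrightarrow> linear_operator X Y (mult_op \<psi>)"
  by (simp add: linear_operator_def mult_op_def fun_eq_iff algebra_simps)

text \<open>The inclusions on \<open>X\<close> and \<open>Y\<close> cover (a) and (b) at once:
  images of bounded sets lie in a dominated compact set inside \<open>wlip0\<close>, hence inside
  either target.\<close>

lemma compact_mult_opI:
  assumes X: "(\<lambda>v. 0) \<in> X" "X \<subseteq> lip adj rt" and Y: "wlip0 adj rt \<subseteq> Y" "Y \<subseteq> wlip adj rt"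
    and lim1: "((\<lambda>v. (real (lv v))\<^sup>2 * D \<psi> v) \<longlongrightarrow> 0) bd"
    and lim2: "((\<lambda>v. (real (lv v) + 1) * cmod (\<psi> v)) \<longlongrightarrow> 0) bd"
  shows "compact_operator X (lip_norm adj rt) Y (wlip_norm adj rt) (mult_op \<psi>)"
proof -
  \<comment> \<open>The two terms of the Leibniz rule after multiplication by \<open>lv v\<close>:
    the first uses \<open>cmod (f v) \<le> 2 * lv v * R\<close>, the second that \<open>lv v\<close>
    is \<open>lv (par v) + 1\<close>, so that the second limit applies at the parent.\<close>
  define e where "e v = 2 * ((real (lv v))\<^sup>2 * D \<psi> v) + (real (lv (par v)) + 1) * cmod (\<psi> (par v))" for v
  have e: "(e \<longlongrightarrow> 0) bd"
  proof -
    have "((\<lambda>v. (real (lv (par v)) + 1) * cmod (\<psi> (par v))) \<longlongrightarrow> 0) bd"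
      using filterlim_compose[OF lim2 filterlim_parent] .
    from tendsto_add[OF tendsto_mult_right_zero[OF lim1, of 2] this] show ?thesis
      unfolding e_def by simp
  qed
  have bound: "real (lv v) * D (mult_op \<psi> f) v \<le> R * e v"
    if f: "f \<in> X" "lip_norm adj rt f \<le> R" and v: "v \<noteq> rt" for f R v
  proof -
    have fL: "f \<in> L.wt_lip" "L.wt_norm f \<le> R" using f X(2) by (auto simp: lip_eq lip_norm_eq)
    have R: "0 \<le> R" using L.wt_norm_nonneg fL by force
    have l1: "1 \<le> real (lv v)" using level_ge_1[OF v] .
    have "cmod (f v) \<le> (real (lv v) + 1) * L.wt_norm f" using L.cmod_le_wt_norm fL by blast
    \<comment> \<open>Off the root, \<open>lv v + 1 \<le> 2 * lv v\<close>.\<close>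
    also have "\<dots> \<le> (2 * real (lv v)) * R" using l1 fL R L.wt_norm_nonneg by (intro mult_mono) auto
    finally have fv: "cmod (f v) \<le> (2 * real (lv v)) * R" .
    have Df: "D f v \<le> R" using L.tree_D_le_wt_norm[OF fL(1) v] fL by linarith
    have "real (lv v) * D (mult_op \<psi> f) v
        \<le> real (lv v) * (D \<psi> v * cmod (f v) + cmod (\<psi> (par v)) * D f v)"
      unfolding mult_op_def using tree_D_mult_le by (intro mult_left_mono) auto
    also have "\<dots> \<le> real (lv v) * (D \<psi> v * ((2 * real (lv v)) * R) + cmod (\<psi> (par v)) * R)"
      using fv Df by (intro mult_left_mono add_mono) (auto simp: tree_D_def)
    also have "\<dots> = R * e v"
      using level_parent[OF v] by (simp add: e_def power2_eq_square algebra_simps)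
    finally show ?thesis .
  qed
  have "mult_op \<psi> f \<in> wlip0 adj rt" if "f \<in> X" for f
    using bound[OF that order_refl] by (rule wlip0I[OF tendsto_mult_right_zero[OF e]])
  then have "linear_operator X Y (mult_op \<psi>)" using Y by (intro linear_operator_mult_op) auto
  moreover have "compactin (Metric_space.mtopology Y (norm_dist Y W.wt_norm))
      (Metric_space.mtopology Y (norm_dist Y W.wt_norm) closure_of (mult_op \<psi> ` B))"
    if mb: "Metric_space.mbounded X (norm_dist X L.wt_norm) B" for B
  proof -
    interpret M: Metric_space Y "norm_dist Y W.wt_norm"
      using W.Metric_space_norm_dist Y by (simp add: wlip_eq)
    obtain R where B: "B \<subseteq> X" and R: "\<And>f. f \<in> B \<Longrightarrow> L.wt_norm f \<le> R"
      using mb L.mbounded_norm_dist_iff[of X B] X by (auto simp: lip_eq)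
    define K where "K = {g. cmod (g rt) \<le> cmod (\<psi> rt) * R \<and>
      (\<forall>v. v \<noteq> rt \<longrightarrow> real (lv v) * D g v \<le> R * e v)}"
    have "K \<subseteq> wlip0 adj rt" unfolding K_def using wlip0I[OF tendsto_mult_right_zero[OF e]] by blast
    then have K: "compactin M.mtopology K"
      using W.compactin_dominated[OF _ tendsto_mult_right_zero[OF e] K_def] Y by (auto simp: wlip_eq)
    have "mult_op \<psi> ` B \<subseteq> K"
    proof (clarsimp simp: K_def, intro conjI allI impI)
      fix f assume f: "f \<in> B"
      have "cmod (f rt) \<le> R" using L.wt_norm_ge_root[of f] R[OF f] f B X by (force simp: lip_eq)
      then show "cmod (mult_op \<psi> f rt) \<le> cmod (\<psi> rt) * R"
        by (simp add: mult_op_def norm_mult mult_left_mono)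
      show "real (lv v) * D (mult_op \<psi> f) v \<le> R * e v" if "v \<noteq> rt" for v
        using bound[OF _ _ that] f B R by (auto simp: lip_norm_eq)
    qed
    \<comment> \<open>A compact set in a metric space is closed, so the closure of the image stays
      in \<open>K\<close> and is compact as a closed subset.\<close>
    moreover have "closedin M.mtopology K"
      using K compactin_imp_closedin M.Hausdorff_space_mtopology by blast
    ultimately show ?thesis
      using K closed_compactin closure_of_minimal closedin_closure_of by metis
  qed
  ultimately show ?thesis
    by (simp add: compact_operator_def lip_norm_eq wlip_norm_eq)
qed

section \<open>Compactness implies condition (c), by test functions\<close>

text \<open>A difference involves only a vertex and its parent, and both eventually leave the
  support.\<close>

lemma finite_support_in_lip0:
  assumes "finite {w. f w \<noteq> 0}"
  shows "f \<in> lip0 adj rt"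
proof -
  have ev: "\<forall>\<^sub>F v in bd. D f v = 0"
    using eventually_0_of_finite_support[OF assms]
      eventually_compose_filterlim[OF eventually_0_of_finite_support[OF assms] filterlim_parent]
    by eventually_elim (simp add: tree_D_def)
  then have lim: "(D f \<longlongrightarrow> 0) bd" by (rule tendsto_eventually)
  obtain M where "\<And>v. D f v \<le> M" using boundary_tendsto_0_imp_bounded[OF lim] by blast
  then have "f \<in> L.wt_lip" by (intro L.wt_lipI) simp
  then show ?thesis using lim by (simp add: lip0_def lip_eq)
qed

lemma zero_in_lip0: "(\<lambda>v. 0) \<in> lip0 adj rt"
  by (rule finite_support_in_lip0) simp

text \<open>Otherwise some sequence of vertices going to the boundary keeps the image norms away
  from zero. By compactness a subsequence of the images converges in norm; its limit must vanish
  pointwise, a contradiction.\<close>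

lemma compact_mult_op_tendsto:
  assumes X: "lip0 adj rt \<subseteq> X" "X \<subseteq> lip adj rt" and Y: "Y \<subseteq> wlip adj rt"
    and comp: "compact_operator X (lip_norm adj rt) Y (wlip_norm adj rt) (mult_op \<psi>)"
    and fin: "\<And>v. finite {w. F v w \<noteq> 0}" and norm: "\<And>v. lip_norm adj rt (F v) \<le> R"
    and ev0: "\<And>w. \<forall>\<^sub>F v in bd. F v w = 0"
  shows "((\<lambda>v. wlip_norm adj rt (mult_op \<psi> (F v))) \<longlongrightarrow> 0) bd"
proof (rule ccontr)
  assume "\<not> ?thesis"
  then obtain \<delta> where \<delta>: "\<delta> > 0" "\<not> (\<forall>\<^sub>F v in bd. dist (W.wt_norm (mult_op \<psi> (F v))) 0 < \<delta>)"
    by (auto simp: tendsto_iff wlip_norm_eq)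
  then have "\<forall>n. \<exists>v. n \<le> lv v \<and> \<delta> \<le> \<bar>W.wt_norm (mult_op \<psi> (F v))\<bar>"
    unfolding eventually_boundary by (auto simp: not_less)
  then obtain s where s: "\<And>n. n \<le> lv (s n)" "\<And>n. \<delta> \<le> \<bar>W.wt_norm (mult_op \<psi> (F (s n)))\<bar>"
    by metis
  interpret M: Metric_space Y "norm_dist Y W.wt_norm"
    using W.Metric_space_norm_dist Y by (simp add: wlip_eq)
  have FX: "range F \<subseteq> X" using finite_support_in_lip0[OF fin] X by auto
  have "Metric_space.mbounded X (norm_dist X L.wt_norm) (range F)"
    using L.mbounded_norm_dist_iff[of X "range F"] X FX zero_in_lip0 norm
    by (auto simp: lip_eq lip_norm_eq)
  then have C: "compactin M.mtopology (M.mtopology closure_of (mult_op \<psi> ` range F))"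
    using comp by (simp add: compact_operator_def lip_norm_eq wlip_norm_eq)
  have inY: "mult_op \<psi> (F v) \<in> Y" for v
    using comp FX by (auto simp: compact_operator_def linear_operator_def)
  then have "mult_op \<psi> ` range F \<subseteq> M.mtopology closure_of (mult_op \<psi> ` range F)"
    by (intro closure_of_subset) auto
  then have "range (\<lambda>n. mult_op \<psi> (F (s n))) \<subseteq> M.mtopology closure_of (mult_op \<psi> ` range F)"
    by blast
  then obtain g r where r: "strict_mono r"
    and g: "limitin M.mtopology ((\<lambda>n. mult_op \<psi> (F (s n))) \<circ> r) g sequentially"
    using C unfolding M.compactin_sequentially by meson
  have gY: "g \<in> Y" using g by (simp add: M.limitin_metric)
  have "((\<lambda>n. norm_dist Y W.wt_norm (mult_op \<psi> (F (s (r n)))) g) \<longlongrightarrow> 0) sequentially"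
    using g by (simp add: M.limitin_metric_dist_null o_def)
  then have lim: "(\<lambda>n. W.wt_norm (\<lambda>v. mult_op \<psi> (F (s (r n))) v - g v)) \<longlonglongrightarrow> 0"
    using inY gY by (simp add: norm_dist_def)
  have "g w = 0" for w
  proof -
    obtain N where N: "\<And>v. N \<le> lv v \<Longrightarrow> F v w = 0" using ev0 unfolding eventually_boundary by blast
    \<comment> \<open>For large \<open>n\<close> the image vanishes at \<open>w\<close>, so
      \<open>- g w\<close> is the value at \<open>w\<close> of a difference whose norm tends to
      zero.\<close>
    have "cmod (g w) \<le> (real (lv w) + 1) * W.wt_norm (\<lambda>v. mult_op \<psi> (F (s (r n))) v - g v)"
      if "N \<le> n" for n
    proof -
      have "N \<le> lv (s (r n))" using that seq_suble[OF r, of n] s(1)[of "r n"] by linarith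
      then have "mult_op \<psi> (F (s (r n))) w = 0" using N by (simp add: mult_op_def)
      moreover have "(\<lambda>v. mult_op \<psi> (F (s (r n))) v - g v) \<in> W.wt_lip"
        using inY gY Y by (intro W.wt_lip_diff) (auto simp: wlip_eq)
      ultimately show ?thesis using W.cmod_le_wt_norm[of _ w] by fastforce
    qed
    then have "cmod (g w) \<le> 0"
      by - (rule LIMSEQ_le_const[OF tendsto_mult_right_zero[OF lim]], blast)
    then show ?thesis by simp
  qed
  then have "(\<lambda>n. W.wt_norm (mult_op \<psi> (F (s (r n))))) \<longlonglongrightarrow> 0" using lim by simp
  from order_tendstoD(2)[OF tendsto_rabs_zero[OF this] \<delta>(1)]
  obtain n where "\<bar>W.wt_norm (mult_op \<psi> (F (s (r n))))\<bar> < \<delta>"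
    by (auto simp: eventually_sequentially)
  then show False using s(2)[of "r n"] by simp
qed

text \<open>Indicators detect the size of \<open>\<psi>\<close> and tents detect its increments. The
  second limit comes first, because it controls the Leibniz error in the estimate for the
  tents.\<close>

lemma compact_mult_opD:
  assumes X: "lip0 adj rt \<subseteq> X" "X \<subseteq> lip adj rt" and Y: "Y \<subseteq> wlip adj rt"
    and comp: "compact_operator X (lip_norm adj rt) Y (wlip_norm adj rt) (mult_op \<psi>)"
  shows "((\<lambda>v. (real (lv v))\<^sup>2 * D \<psi> v) \<longlongrightarrow> 0) bd"
    and "((\<lambda>v. (real (lv v) + 1) * cmod (\<psi> v)) \<longlongrightarrow> 0) bd"
proof -
  note key = compact_mult_op_tendsto[OF X Y comp]
  have inW: "mult_op \<psi> f \<in> W.wt_lip" if "finite {w. f w \<noteq> 0}" for f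
    using comp finite_support_in_lip0[OF that] X Y
    by (auto simp: compact_operator_def linear_operator_def wlip_eq)
  define I :: "'v \<Rightarrow> 'v \<Rightarrow> complex" where "I v w = (if w = v then 1 else 0)" for v w
  have finI: "finite {w. I v w \<noteq> 0}" for v by (simp add: I_def)
  have "((\<lambda>v. wlip_norm adj rt (mult_op \<psi> (I v))) \<longlongrightarrow> 0) bd"
  proof (rule key[OF finI])
    fix v
    have "L.wt_norm (I v) \<le> cmod (I v rt) + 1"
      by (rule L.wt_norm_leI) (simp add: tree_D_def I_def)
    also have "\<dots> \<le> 2" by (simp add: I_def)
    finally show "lip_norm adj rt (I v) \<le> 2" by (simp add: lip_norm_eq)
  next
    fix w
    show "\<forall>\<^sub>F v in bd. I v w = 0"
      unfolding eventually_boundary I_def by (rule exI[of _ "Suc (lv w)"]) auto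
  qed
  \<comment> \<open>The factor 2 pays for replacing the weight \<open>lv v\<close> by
    \<open>lv v + 1\<close>.\<close>
  then have limI: "((\<lambda>v. 2 * W.wt_norm (mult_op \<psi> (I v))) \<longlongrightarrow> 0) bd"
    by (intro tendsto_mult_right_zero) (simp add: wlip_norm_eq)
  show lim2: "((\<lambda>v. (real (lv v) + 1) * cmod (\<psi> v)) \<longlongrightarrow> 0) bd"
  proof (rule tendsto_sandwich[OF _ _ tendsto_const limI])
    show "\<forall>\<^sub>F v in bd. (real (lv v) + 1) * cmod (\<psi> v) \<le> 2 * W.wt_norm (mult_op \<psi> (I v))"
      using eventually_nonroot
    proof eventually_elim
      case (elim v)
      have "par v \<noteq> v" using level_parent[OF elim] by (metis n_not_Suc_n)
      then have "D (mult_op \<psi> (I v)) v = cmod (\<psi> v)" by (simp add: tree_D_def mult_op_def I_def)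
      then have "real (lv v) * cmod (\<psi> v) \<le> W.wt_norm (mult_op \<psi> (I v))"
        using W.weighted_D_le_wt_norm[OF inW[OF finI] elim] by metis
      moreover have "1 * cmod (\<psi> v) \<le> real (lv v) * cmod (\<psi> v)"
        using level_ge_1[OF elim] by (intro mult_right_mono) auto
      ultimately show ?case by (simp add: algebra_simps)
    qed
  qed simp
  \<comment> \<open>A radial tent of slope 2 with peak \<open>lv v\<close> at level
    \<open>lv v\<close>, positive only strictly between levels \<open>lv v / 2\<close> and
    \<open>3 * lv v / 2\<close>. Slope 2 keeps the Lipschitz norms uniformly bounded, and the inner
    edge moves out with \<open>v\<close>, so the tents tend to zero pointwise; a tent of slope 1
    rising from the root would not.\<close>
  define h :: "'v \<Rightarrow> 'v \<Rightarrow> real"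
    where "h v w = max 0 (real (lv v) - \<bar>2 * real (lv v) - 2 * real (lv w)\<bar>)" for v w
  define T :: "'v \<Rightarrow> 'v \<Rightarrow> complex" where "T v w = of_real (h v w)" for v w
  have finT: "finite {w. T v w \<noteq> 0}" for v
    by (rule finite_subset[OF _ finite_level_le[of "2 * lv v"]]) (auto simp: T_def h_def)
  have DT: "D (T v) w \<le> 2" if "w \<noteq> rt" for v w
  proof -
    have "D (T v) w = \<bar>h v w - h v (par w)\<bar>"
      unfolding tree_D_def T_def by (metis norm_of_real of_real_diff)
    also have "\<dots> \<le> 2" using level_parent[OF that] unfolding h_def by linarith
    finally show ?thesis .
  qed
  have "((\<lambda>v. wlip_norm adj rt (mult_op \<psi> (T v))) \<longlongrightarrow> 0) bd"
  proof (rule key[OF finT])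
    fix v
    have "L.wt_norm (T v) \<le> cmod (T v rt) + 2" using DT by (intro L.wt_norm_leI) simp
    also have "\<dots> \<le> 2" by (simp add: T_def h_def)
    finally show "lip_norm adj rt (T v) \<le> 2" by (simp add: lip_norm_eq)
  next
    fix w
    show "\<forall>\<^sub>F v in bd. T v w = 0"
      \<comment> \<open>Once \<open>lv v \<ge> 2 * lv w\<close>, the vertex \<open>w\<close> lies on
        or inside the inner edge of the tent.\<close>
      unfolding eventually_boundary T_def h_def by (rule exI[of _ "2 * lv w"]) auto
  qed
  \<comment> \<open>The second summand bounds the Leibniz error: the tent has increment at most 2,
    and \<open>lv v\<close> equals \<open>lv (par v) + 1\<close>.\<close>
  then have limT: "((\<lambda>v. W.wt_norm (mult_op \<psi> (T v))
      + 2 * ((real (lv (par v)) + 1) * cmod (\<psi> (par v)))) \<longlongrightarrow> 0) bd"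
    using tendsto_mult_right_zero[OF filterlim_compose[OF lim2 filterlim_parent], of 2]
    by (intro tendsto_add_zero) (auto simp: wlip_norm_eq)
  show "((\<lambda>v. (real (lv v))\<^sup>2 * D \<psi> v) \<longlongrightarrow> 0) bd"
  proof (rule tendsto_sandwich[OF _ _ tendsto_const limT])
    show "\<forall>\<^sub>F v in bd. (real (lv v))\<^sup>2 * D \<psi> v \<le> W.wt_norm (mult_op \<psi> (T v))
        + 2 * ((real (lv (par v)) + 1) * cmod (\<psi> (par v)))"
      using eventually_nonroot
    proof eventually_elim
      case (elim v)
      have "cmod (T v v) = real (lv v)" by (simp add: T_def h_def)
      then have "D \<psi> v * real (lv v) - cmod (\<psi> (par v)) * D (T v) v \<le> D (mult_op \<psi> (T v)) v"
        using tree_D_mult_ge[of \<psi> v "T v"] by (simp add: mult_op_def)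
      moreover have "cmod (\<psi> (par v)) * D (T v) v \<le> cmod (\<psi> (par v)) * 2"
        using DT[OF elim] by (intro mult_left_mono) auto
      ultimately have "D \<psi> v * real (lv v) \<le> D (mult_op \<psi> (T v)) v + cmod (\<psi> (par v)) * 2"
        by linarith
      then have "real (lv v) * (D \<psi> v * real (lv v))
          \<le> real (lv v) * (D (mult_op \<psi> (T v)) v + cmod (\<psi> (par v)) * 2)"
        by (intro mult_left_mono) auto
      also have "\<dots> = real (lv v) * D (mult_op \<psi> (T v)) v
          + 2 * ((real (lv (par v)) + 1) * cmod (\<psi> (par v)))"
        using level_parent[OF elim] by (simp add: algebra_simps)
      also have "\<dots> \<le> W.wt_norm (mult_op \<psi> (T v))
          + 2 * ((real (lv (par v)) + 1) * cmod (\<psi> (par v)))"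
        using W.weighted_D_le_wt_norm[OF inW[OF finT] elim] by simp
      finally show ?case by (simp add: power2_eq_square mult_ac)
    qed
  qed (simp add: tree_D_def)
qed

end

theorem theorem3p4:
  fixes adj :: "'v \<Rightarrow> 'v \<Rightarrow> bool" and rt :: 'v and \<psi> :: "'v \<Rightarrow> complex"
  assumes "infinite_tree adj"
    and "bounded_operator (lip adj rt) (lip_norm adj rt) (wlip adj rt) (wlip_norm adj rt) (mult_op \<psi>)
       \<or> bounded_operator (lip0 adj rt) (lip_norm adj rt) (wlip0 adj rt) (wlip_norm adj rt) (mult_op \<psi>)"
  shows
    "(compact_operator (lip adj rt) (lip_norm adj rt) (wlip adj rt) (wlip_norm adj rt) (mult_op \<psi>)
      \<longleftrightarrow> compact_operator (lip0 adj rt) (lip_norm adj rt) (wlip0 adj rt) (wlip_norm adj rt) (mult_op \<psi>))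
   \<and> (compact_operator (lip0 adj rt) (lip_norm adj rt) (wlip0 adj rt) (wlip_norm adj rt) (mult_op \<psi>)
      \<longleftrightarrow> ((\<lambda>v. (real (level adj rt v))\<^sup>2 * tree_D adj rt \<psi> v) \<longlongrightarrow> 0) (at_boundary adj rt)
        \<and> ((\<lambda>v. (real (level adj rt v) + 1) * cmod (\<psi> v)) \<longlongrightarrow> 0) (at_boundary adj rt))"
proof -
  interpret rooted_tree adj rt
    using assms(1) by (simp add: rooted_tree_def)
  have sub: "lip0 adj rt \<subseteq> lip adj rt" "wlip0 adj rt \<subseteq> wlip adj rt"
    by (auto simp: lip0_def wlip0_def)
  show ?thesis
    \<comment> \<open>Each pair of spaces satisfies the inclusions for both directions, so (a) and
      (b) are each equivalent to (c).\<close>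
    using compact_mult_opI[of "lip adj rt" "wlip adj rt" \<psi>]
      compact_mult_opI[of "lip0 adj rt" "wlip0 adj rt" \<psi>]
      compact_mult_opD[of "lip adj rt" "wlip adj rt" \<psi>]
      compact_mult_opD[of "lip0 adj rt" "wlip0 adj rt" \<psi>]
      sub zero_in_lip0
    by blast
qed

end
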